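(* Let $a$ be a real number with $0<a<1$, and let $\alpha$ be a badly approximable real number, i.e. $\inf_{q\ge1} q\,\|q\alpha\|>0$. Then the set of real numbers $\beta$ such that $$\liminf_{q\to+\infty}\, q\,(\log q)^{2-a}\,\bigl(\log (1/\|q\alpha\|)\bigr)^a\,\|q\alpha\|\,\|q\beta\|>0$$ (where $q$ runs over positive integers) has Hausdorff dimension $1$.
   Context: For a real number $x$, $\|x\|$ denotes the distance from $x$ to the nearest integer. *)

theory Defs
  imports "HOL-Analysis.Analysis" "HOL-Library.Liminf_Limsup"
begin

definition dist_nint :: "real \<Rightarrow> real" where
  "dist_nint x = \<bar>x - real_of_int (round x)\<bar>"

definition hausdorff_pre :: "real \<Rightarrow> real \<Rightarrow> real set \<Rightarrow> ennreal" where
  "hausdorff_pre s \<delta> E =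
     (INF U \<in> {U :: nat \<Rightarrow> real set. E \<subseteq> (\<Union>i. U i) \<and>
                 (\<forall>i. bounded (U i) \<and> diameter (U i) \<le> \<delta>)}.
        (\<Sum>i. ennreal (diameter (U i) powr s)))"

definition hausdorff_measure :: "real \<Rightarrow> real set \<Rightarrow> ennreal" where
  "hausdorff_measure s E = (SUP \<delta> \<in> {0<..}. hausdorff_pre s \<delta> E)"

text \<open>Hausdorff dimension: infimum of the positive s with H^s(E) = 0.
  (For subsets of the real line this set always contains every s > 1.)\<close>
definition hausdorff_dim :: "real set \<Rightarrow> real" where
  "hausdorff_dim E = Inf {s. s > 0 \<and> hausdorff_measure s E = 0}"

end

theory Submission
  imports Defs
begin

text \<open>
  Fix \<open>s < 1\<close> and a countable cover \<open>(U\<^sub>i)\<close> of total \<open>s\<close>-cost \<open>\<Sum> d\<^sub>i\<^sup>s\<close> small. We look for a \<open>\<beta>\<close> in the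
  set that lies in no \<open>U\<^sub>i\<close>, so that the \<open>s\<close>-dimensional measure cannot vanish. The obstacles are the
  \<open>U\<^sub>i\<close> and the strips \<open>\<bar>q \<beta> - p\<bar> \<le> \<delta> q\<close>, where \<open>\<delta> q\<close> is \<open>c\<close> divided by the weight of \<open>q\<close>.

  Since \<open>\<alpha>\<close> is badly approximable, the points \<open>q \<alpha>\<close> mod 1 with \<open>q < 2^m\<close> are \<open>2^-m\<close>-separated up to
  a constant, so about \<open>2^(m - j)\<close> of the \<open>q \<in> [2^m, 2^(m+1))\<close> have \<open>\<parallel>q \<alpha>\<parallel>\<close> of order \<open>2^-j\<close>. Hence the sum
  of \<open>\<delta> q\<close> over this range is \<open>O(c m^(a-2) \<Sum>\<^sub>j j^-a) = O(c / m)\<close>, and over a block \<open>[Q, Q^5)\<close> it is \<open>O(c)\<close>.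

  Choose nested intervals of lengths \<open>1 / Q\<^sub>k\<close> with \<open>Q\<^sub>k\<^sub>+\<^sub>1 = Q\<^sub>k^5\<close>. On an interval of length \<open>1 / Q\<^sub>k\<close> the
  strips with \<open>q \<ge> Q\<^sub>k\<close> occupy a proportion \<open>O(\<delta> q)\<close>, while those with \<open>q < Q\<^sub>k\<close> are wider than
  \<open>1 / Q\<^sub>k\<^sub>+\<^sub>1\<close> and are disposed of by the next subdivision. Averaging a load, which charges 1 for an
  obstacle wider than the interval and ten times its relative size to the power \<open>s\<close> (1 for strips)
  otherwise, shows that some subinterval again has load less than 1.
\<close>

section \<open>Costs of obstacles and how they change under subdivision\<close>

definition hits :: "real set \<Rightarrow> real \<Rightarrow> real \<Rightarrow> real" where
  "hits U x r = of_bool (U \<inter> {x..x + r} \<noteq> {})"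

text \<open>The value 1 for \<open>d \<ge> r\<close> makes a load below 1 incompatible with meeting
  an obstacle at least as wide as the interval. The factor 10 on narrower obstacles pays for the
  factor 3 lost in a subdivision, leaving a contraction by 3/10.\<close>

definition cost :: "real \<Rightarrow> real \<Rightarrow> real \<Rightarrow> real" where
  "cost s d r = (if d < r then 10 * (d / r) powr s else 1)"

lemma hits_nonneg: "0 \<le> hits U x r" and hits_le_1: "hits U x r \<le> 1"
  by (auto simp: hits_def)

lemma cost_nonneg: "0 \<le> cost s d r"
  by (auto simp: cost_def)

text \<open>The counting tool for child intervals met by an obstacle, for strips met by an interval,
  and for denominators with small norm. Finiteness comes out of the spread bound: one element
  confines all the others.\<close>

lemma card_le_of_spread:
  fixes S :: "int set" and L :: real
  assumes "\<And>i j. i \<in> S \<Longrightarrow> j \<in> S \<Longrightarrow> real_of_int (j - i) \<le> L" "0 \<le> L"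
  shows "real (card S) \<le> L + 1"
proof (cases "S = {}")
  case True
  then show ?thesis using assms by simp
next
  case False
  then obtain i0 where i0: "i0 \<in> S" by blast
  have "S \<subseteq> {i0 - \<lfloor>L\<rfloor>..i0 + \<lfloor>L\<rfloor>}"
  proof
    fix j assume "j \<in> S"
    then have "j - i0 \<le> \<lfloor>L\<rfloor>" "i0 - j \<le> \<lfloor>L\<rfloor>"
      using assms(1)[OF i0, of j] assms(1)[of j i0] i0 by (auto simp: le_floor_iff)
    then show "j \<in> {i0 - \<lfloor>L\<rfloor>..i0 + \<lfloor>L\<rfloor>}" by auto
  qed
  then have fin: "finite S" using finite_subset by blast
  have spread: "Max S - Min S \<le> \<lfloor>L\<rfloor>"
    using assms(1)[of "Min S" "Max S"] fin False by (auto simp: le_floor_iff)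
  have "S \<subseteq> {Min S..Max S}" using fin by auto
  then have "card S \<le> card {Min S..Max S}" by (intro card_mono) auto
  moreover have "Min S \<le> Max S" using fin False by (meson Max_in Min_le)
  ultimately have "int (card S) \<le> Max S - Min S + 1" by simp
  with spread have "int (card S) \<le> \<lfloor>L\<rfloor> + 1" by linarith
  then have "real (card S) \<le> real_of_int \<lfloor>L\<rfloor> + 1" by linarith
  then show ?thesis using of_int_floor_le[of L] by linarith
qed

text \<open>Two points of \<open>U\<close> are at most \<open>d\<close> apart, so the indices of two
  children that are met differ by at most \<open>d / r + 1\<close>. If the parent is not met, no
  child is.\<close>

lemma sum_hits_children:
  assumes U: "\<And>y z. y \<in> U \<Longrightarrow> z \<in> U \<Longrightarrow> \<bar>y - z\<bar> \<le> d" and "0 < r" "0 \<le> d"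
  shows "(\<Sum>j<N. hits U (x + real j * r) r) \<le> (d / r + 2) * hits U x (real N * r)"
proof (cases "U \<inter> {x..x + real N * r} = {}")
  case True
  have "hits U (x + real j * r) r = 0" if "j < N" for j
  proof -
    have "real (Suc j) \<le> real N" using that by linarith
    then have "real (Suc j) * r \<le> real N * r" using \<open>0 < r\<close> by (intro mult_right_mono) auto
    moreover have "0 \<le> real j * r" using \<open>0 < r\<close> by simp
    ultimately have "{x + real j * r..x + real j * r + r} \<subseteq> {x..x + real N * r}"
      by (auto simp: algebra_simps)
    then show ?thesis using True unfolding hits_def by (auto simp: subset_iff disjoint_iff)
  qed
  then show ?thesis by (simp add: hits_def True)
next
  case False
  let ?T = "{j. j < N \<and> U \<inter> {x + real j * r..x + real j * r + r} \<noteq> {}}"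
  have "(\<Sum>j<N. hits U (x + real j * r) r) = (\<Sum>j\<in>?T. 1)"
    unfolding hits_def by (rule sum.mono_neutral_cong_right) auto
  also have "\<dots> = real (card (int ` ?T))"
    by (simp add: card_image)
  also have "\<dots> \<le> (d / r + 1) + 1"
  proof (rule card_le_of_spread)
    fix i j assume "i \<in> int ` ?T" "j \<in> int ` ?T"
    then obtain i' j' where ij: "i = int i'" "j = int j'" "i' \<in> ?T" "j' \<in> ?T" by auto
    then obtain y z where yz: "y \<in> U" "z \<in> U" "y \<le> x + real i' * r + r" "x + real j' * r \<le> z" by auto
    have "real j' * r - real i' * r \<le> d + r" using U[OF yz(1,2)] yz by linarith
    then have "(real j' - real i') * r \<le> (d / r + 1) * r"
      using \<open>0 < r\<close> by (simp add: distrib_right left_diff_distrib)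
    then have "real j' - real i' \<le> d / r + 1" using \<open>0 < r\<close> by simp
    then show "real_of_int (j - i) \<le> d / r + 1" using ij by simp
  qed (use assms in auto)
  finally show ?thesis using False by (simp add: hits_def)
qed

text \<open>Both cases reach \<open>3 * N * (d / R) powr s\<close>. If \<open>d < r\<close>, at most
  3 children are counted and rescaling costs \<open>N powr s\<close>, at most a tenth of
  \<open>N\<close>. Otherwise \<open>d / r + 2\<close> is at most \<open>3 * (d / r)\<close>, and
  lowering the exponent from 1 to \<open>s\<close> only enlarges \<open>d / R < 1\<close>.\<close>

lemma cost_children_decay:
  assumes "0 < d" "d < R" "R = real N * r" "0 < r" "0 < s" "s < 1" "10 \<le> real N powr (1 - s)"
  shows "(d / r + 2) * cost s d r \<le> real N * (3 / 10) * cost s d R"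
proof -
  have N: "0 < real N" using assms by (cases N) auto
  have dR: "d / r = real N * (d / R)" using assms N by simp
  have R: "0 < R" using assms by simp
  show ?thesis
  proof (cases "d < r")
    case True
    have "(d / r) powr s = real N powr s * (d / R) powr s"
      unfolding dR by (rule powr_mult)
    moreover have "real N powr s * 10 \<le> real N powr s * real N powr (1 - s)"
      using assms by (intro mult_left_mono) auto
    then have "real N powr s * 10 \<le> real N"
      using N by (simp flip: powr_add)
    then have "real N powr s * 10 * (d / R) powr s \<le> real N * (d / R) powr s"
      by (intro mult_right_mono) auto
    ultimately have 1: "10 * (d / r) powr s \<le> real N * (d / R) powr s" by simp
    have "(d / r + 2) * cost s d r \<le> 3 * (10 * (d / r) powr s)"
      using True assms unfolding cost_def by (intro mult_mono) auto
    also have "\<dots> \<le> 3 * (real N * (d / R) powr s)" using 1 by linarith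
    finally show ?thesis using assms by (simp add: cost_def)
  next
    case False
    then have "1 \<le> d / r" using assms by simp
    then have "(d / r + 2) * cost s d r \<le> 3 * (d / r)" using False by (simp add: cost_def)
    also have "\<dots> = 3 * real N * (d / R) powr 1" using dR assms R N by simp
    also have "\<dots> \<le> 3 * real N * (d / R) powr s"
      using assms R by (intro mult_left_mono powr_mono') auto
    finally show ?thesis using assms by (simp add: cost_def)
  qed
qed

text \<open>Exponent 1 offers no gain \<open>N powr (1 - s)\<close>, so the contraction relies on
  the cost at the child being capped at 1, that is, on \<open>r \<le> d\<close>.\<close>

lemma cost_children_linear_old:
  assumes "r \<le> d" "d < R" "R = real N * r" "0 < r"
  shows "(d / r + 2) * cost 1 d r \<le> real N * (3 / 10) * cost 1 d R"
proof -
  have N: "0 < real N" using assms by (cases N) auto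
  have dR: "d / r = real N * (d / R)" using assms N by simp
  have "1 \<le> d / r" using assms by simp
  moreover have "cost 1 d r = 1" using assms by (simp add: cost_def)
  ultimately have "(d / r + 2) * cost 1 d r \<le> 3 * (d / r)" by simp
  also have "\<dots> = real N * (3 / 10) * cost 1 d R" using assms dR N by (simp add: cost_def)
  finally show ?thesis .
qed

text \<open>For strips entering the load for the first time: no contraction, only a bound by
  relative size, where 30 is 3 times the factor 10 in \<open>cost\<close>.\<close>

lemma cost_children_linear_new:
  assumes "0 < d" "R = real N * r" "0 < R" "0 < r"
  shows "(d / r + 2) * cost 1 d r \<le> 30 * real N * (d / R)"
proof -
  have N: "0 < real N" using assms by (cases N) auto
  have dR: "d / r = real N * (d / R)" using assms N by simp
  have "(d / r + 2) * cost 1 d r \<le> 30 * (d / r)"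
  proof (cases "d < r")
    case True
    then have "(d / r + 2) * cost 1 d r \<le> 3 * (10 * (d / r))"
      using assms unfolding cost_def by (intro mult_mono) auto
    then show ?thesis by simp
  next
    case False
    then have "1 \<le> d / r" using assms by simp
    then show ?thesis using False by (simp add: cost_def)
  qed
  then show ?thesis using dR by simp
qed

definition strip :: "(nat \<Rightarrow> real) \<Rightarrow> nat \<Rightarrow> int \<Rightarrow> real set" where
  "strip \<delta> q p = {\<beta>. \<bar>real q * \<beta> - of_int p\<bar> \<le> \<delta> q}"

lemma strip_spread:
  assumes "y \<in> strip \<delta> q p" "z \<in> strip \<delta> q p" "0 < q"
  shows "\<bar>y - z\<bar> \<le> 2 * \<delta> q / real q"
proof -
  have "\<bar>real q * y - real q * z\<bar> \<le> 2 * \<delta> q" using assms by (auto simp: strip_def)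
  then have "real q * \<bar>y - z\<bar> \<le> 2 * \<delta> q" using \<open>0 < q\<close>
    by (simp add: abs_mult flip: right_diff_distrib)
  then show ?thesis using assms by (simp add: field_simps)
qed

text \<open>The centres \<open>p / q\<close> are \<open>1 / q\<close> apart, so at most
  \<open>q * R + 2 * \<delta> q + 1\<close> strips are met; \<open>\<delta> q \<le> 1\<close> and
  \<open>1 \<le> q * R\<close> turn this into \<open>4 * (q * R)\<close>.\<close>

lemma sum_hits_strips:
  assumes "0 < q" "0 < \<delta> q" "\<delta> q \<le> 1" "1 \<le> real q * R" "finite P"
  shows "(\<Sum>p\<in>P. hits (strip \<delta> q p) x R) \<le> 4 * (real q * R)"
proof -
  let ?T = "{p\<in>P. strip \<delta> q p \<inter> {x..x + R} \<noteq> {}}"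
  have "(\<Sum>p\<in>P. hits (strip \<delta> q p) x R) = (\<Sum>p\<in>?T. 1)"
    unfolding hits_def using assms by (intro sum.mono_neutral_cong_right) auto
  also have "\<dots> = real (card ?T)" by simp
  also have "\<dots> \<le> (real q * R + 2 * \<delta> q) + 1"
  proof (rule card_le_of_spread)
    fix i j assume "i \<in> ?T" "j \<in> ?T"
    then obtain y z where yz: "y \<in> strip \<delta> q i" "z \<in> strip \<delta> q j" "x \<le> y" "z \<le> x + R" by auto
    then have "real q * (z - y) \<le> real q * R" using assms by (intro mult_left_mono) auto
    then show "real_of_int (j - i) \<le> real q * R + 2 * \<delta> q"
      using yz by (auto simp: strip_def algebra_simps)
  qed (use assms in auto)
  finally show ?thesis using assms by linarith
qed

subsection \<open>Nested intervals\<close>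

lemma exists_less_of_sum_less:
  fixes f :: "nat \<Rightarrow> real"
  assumes "(\<Sum>j<N. f j) < real N * c"
  shows "\<exists>j<N. f j < c"
proof (rule ccontr)
  assume "\<not> ?thesis"
  then have "c \<le> f j" if "j < N" for j using that not_less by blast
  then have "(\<Sum>j<N. c) \<le> (\<Sum>j<N. f j)" by (intro sum_mono) simp
  then show False using assms by simp
qed

text \<open>Intervals of generation \<open>k\<close> have length \<open>1 / Q k\<close> and split
  into \<open>N k\<close> children. \<open>N_powr\<close> drives the decay of the cover load and
  \<open>d_sum\<close> starts it below 1; \<open>\<delta>_sum\<close> is the budget for the strips
  entering at one generation; \<open>\<delta>_lower\<close> makes every earlier strip at least as
  wide as a child.\<close>

locale obstacle_course =
  fixes s :: real and Q N :: "nat \<Rightarrow> nat" and \<delta> d :: "nat \<Rightarrow> real" and U :: "nat \<Rightarrow> real set"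
  assumes s: "0 < s" "s < 1"
    and Q0: "0 < Q 0"
    and Q_Suc: "\<And>k. Q (Suc k) = N k * Q k"
    and N_ge: "\<And>k. 2 \<le> N k"
    and N_powr: "\<And>k. 10 \<le> real (N k) powr (1 - s)"
    and \<delta>_pos: "\<And>q. Q 0 \<le> q \<Longrightarrow> 0 < \<delta> q"
    and \<delta>_sum: "\<And>k. (\<Sum>q\<in>{Q k..<Q (Suc k)}. \<delta> q) \<le> 1 / 400"
    and \<delta>_lower: "\<And>k q. Q 0 \<le> q \<Longrightarrow> q < Q k \<Longrightarrow> 1 / real (Q (Suc k)) \<le> 2 * \<delta> q / real q"
    and d_pos: "\<And>i. 0 < d i"
    and U_spread: "\<And>i y z. y \<in> U i \<Longrightarrow> z \<in> U i \<Longrightarrow> \<bar>y - z\<bar> \<le> d i"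
    and d_summable: "summable (\<lambda>i. d i powr s)"
    and d_sum: "(\<Sum>i. d i powr s) < (1 / real (Q 0)) powr s / 10"
begin

definition \<rho> :: "nat \<Rightarrow> real" where "\<rho> k = 1 / real (Q k)"

definition cover_load :: "nat \<Rightarrow> real \<Rightarrow> real" where
  "cover_load k x = (\<Sum>i. hits (U i) x (\<rho> k) * cost s (d i) (\<rho> k))"

text \<open>The numerators \<open>0..q\<close> suffice because the construction stays inside
  [0, 1].\<close>

definition strip_load_at :: "nat \<Rightarrow> nat \<Rightarrow> real \<Rightarrow> real" where
  "strip_load_at k q x = (\<Sum>p\<in>{0..int q}. hits (strip \<delta> q p) x (\<rho> k) * cost 1 (2 * \<delta> q / real q) (\<rho> k))"

text \<open>Denominators enter one block at a time, so the load at generation 0 is an empty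
  sum.\<close>

definition strip_load :: "nat \<Rightarrow> real \<Rightarrow> real" where
  "strip_load k x = (\<Sum>q\<in>{Q 0..<Q k}. strip_load_at k q x)"

lemma Q_pos: "0 < Q k"
  using N_ge by (induction k) (auto simp: Q0 Q_Suc intro: less_le_trans[of 0 2])

lemma Q_mono: "mono Q"
  using N_ge by (intro mono_iff_le_Suc[THEN iffD2]) (simp add: Q_Suc Suc_leD numeral_2_eq_2)

lemma \<rho>_pos: "0 < \<rho> k"
  using Q_pos by (simp add: \<rho>_def)

lemma \<rho>_Suc: "\<rho> k = real (N k) * \<rho> (Suc k)"
  using N_ge[of k] Q_pos[of k] by (simp add: \<rho>_def Q_Suc)

lemma Q_ge: "k \<le> Q k"
proof (induction k)
  case (Suc k)
  have "2 * Q k \<le> Q (Suc k)" using N_ge[of k] by (simp add: Q_Suc)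
  then show ?case using Suc Q_pos[of k] by linarith
qed simp

lemma \<delta>_le_1:
  assumes "Q k \<le> q" "q < Q (Suc k)"
  shows "\<delta> q \<le> 1"
proof -
  have "\<delta> q \<le> (\<Sum>q\<in>{Q k..<Q (Suc k)}. \<delta> q)"
  proof (rule member_le_sum)
    fix x assume "x \<in> {Q k..<Q (Suc k)} - {q}"
    then have "Q 0 \<le> x" using monoD[OF Q_mono, of 0 k] by auto
    then show "0 \<le> \<delta> x" using \<delta>_pos less_imp_le by blast
  qed (use assms in auto)
  then show ?thesis using \<delta>_sum[of k] by simp
qed

lemma cost_cover_le: "cost s (d i) (\<rho> k) \<le> 10 * (d i powr s / \<rho> k powr s)"
proof -
  have "1 \<le> 10 * (d i / \<rho> k) powr s" if "\<rho> k \<le> d i"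
    using that \<rho>_pos[of k] s ge_one_powr_ge_zero[of "d i / \<rho> k" s] by simp
  then show ?thesis using d_pos[of i] \<rho>_pos[of k] by (auto simp: cost_def powr_divide)
qed

lemma cover_load_summable: "summable (\<lambda>i. hits (U i) x (\<rho> k) * cost s (d i) (\<rho> k))"
proof (rule summable_comparison_test)
  show "summable (\<lambda>i. 10 * (d i powr s / \<rho> k powr s))"
    using d_summable by (intro summable_mult summable_divide)
  have "hits (U i) x (\<rho> k) * cost s (d i) (\<rho> k) \<le> 1 * (10 * (d i powr s / \<rho> k powr s))" for i
    by (intro mult_mono cost_cover_le hits_le_1 cost_nonneg) auto
  then show "\<exists>M. \<forall>i\<ge>M. norm (hits (U i) x (\<rho> k) * cost s (d i) (\<rho> k)) \<le> 10 * (d i powr s / \<rho> k powr s)"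
    using hits_nonneg cost_nonneg by auto
qed

lemma cover_load_nonneg: "0 \<le> cover_load k x"
  unfolding cover_load_def
  by (intro suminf_nonneg cover_load_summable mult_nonneg_nonneg hits_nonneg cost_nonneg)

lemma strip_load_at_nonneg: "0 \<le> strip_load_at k q x"
  unfolding strip_load_at_def
  by (intro sum_nonneg mult_nonneg_nonneg hits_nonneg cost_nonneg)

lemma strip_load_nonneg: "0 \<le> strip_load k x"
  unfolding strip_load_def by (intro sum_nonneg strip_load_at_nonneg)

lemma cover_load_initial: "cover_load 0 x < 1"
proof -
  have "cover_load 0 x \<le> (\<Sum>i. 10 * (d i powr s / \<rho> 0 powr s))"
    unfolding cover_load_def
  proof (rule suminf_le)
    show "hits (U i) x (\<rho> 0) * cost s (d i) (\<rho> 0) \<le> 10 * (d i powr s / \<rho> 0 powr s)" for i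
      using mult_mono[OF hits_le_1 cost_cover_le _ cost_nonneg, of "U i" x "\<rho> 0" i 0] by simp
  qed (intro cover_load_summable summable_mult summable_divide d_summable)+
  also have "\<dots> = 10 * ((\<Sum>i. d i powr s) / \<rho> 0 powr s)"
    using d_summable by (simp add: suminf_mult suminf_divide summable_divide)
  also have "\<dots> < 1"
    using d_sum \<rho>_pos[of 0] by (simp add: \<rho>_def field_simps)
  finally show ?thesis .
qed

text \<open>A single such hit would contribute 1 to the load.\<close>

lemma cover_hit_small:
  assumes "cover_load k x < 1" "\<rho> k \<le> d i"
  shows "hits (U i) x (\<rho> k) = 0"
proof -
  have "hits (U i) x (\<rho> k) * cost s (d i) (\<rho> k) \<le> cover_load k x"
    unfolding cover_load_def
    using sum_le_suminf[OF cover_load_summable, of "{i}" x k] hits_nonneg cost_nonneg by simp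
  then have "hits (U i) x (\<rho> k) < 1" using assms by (simp add: cost_def)
  then show ?thesis by (simp add: hits_def split: if_splits)
qed

lemma strip_hit_small:
  assumes "strip_load k x < 1" "\<rho> k \<le> 2 * \<delta> q / real q" "q \<in> {Q 0..<Q k}" "p \<in> {0..int q}"
  shows "hits (strip \<delta> q p) x (\<rho> k) = 0"
proof -
  have "hits (strip \<delta> q p) x (\<rho> k) * cost 1 (2 * \<delta> q / real q) (\<rho> k) \<le> strip_load_at k q x"
    unfolding strip_load_at_def
    by (rule member_le_sum[OF assms(4)]) (auto intro!: mult_nonneg_nonneg hits_nonneg cost_nonneg)
  also have "\<dots> \<le> strip_load k x"
    unfolding strip_load_def
    by (rule member_le_sum[OF assms(3)]) (auto intro!: strip_load_at_nonneg)
  finally have "hits (strip \<delta> q p) x (\<rho> k) < 1" using assms by (simp add: cost_def)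
  then show ?thesis by (simp add: hits_def split: if_splits)
qed

lemma sum_hits_child:
  assumes "\<And>y z. y \<in> V \<Longrightarrow> z \<in> V \<Longrightarrow> \<bar>y - z\<bar> \<le> e" "0 \<le> e"
  shows "(\<Sum>j<N k. hits V (x + real j * \<rho> (Suc k)) (\<rho> (Suc k))) \<le> (e / \<rho> (Suc k) + 2) * hits V x (\<rho> k)"
  using sum_hits_children[where N = "N k" and x = x, OF assms(1) \<rho>_pos[of "Suc k"] assms(2)] by (simp add: \<rho>_Suc[of k])

lemma cover_load_children:
  assumes "cover_load k x < 1"
  shows "(\<Sum>j<N k. cover_load (Suc k) (x + real j * \<rho> (Suc k))) \<le> real (N k) * (3 / 10) * cover_load k x"
proof -
  let ?r = "\<rho> (Suc k)"
  have "(\<Sum>j<N k. cover_load (Suc k) (x + real j * ?r))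
      = (\<Sum>i. \<Sum>j<N k. hits (U i) (x + real j * ?r) ?r * cost s (d i) ?r)"
    unfolding cover_load_def by (rule suminf_sum[symmetric]) (rule cover_load_summable)
  also have "\<dots> \<le> (\<Sum>i. real (N k) * (3 / 10) * (hits (U i) x (\<rho> k) * cost s (d i) (\<rho> k)))"
  proof (rule suminf_le)
    fix i
    have "(\<Sum>j<N k. hits (U i) (x + real j * ?r) ?r * cost s (d i) ?r)
       \<le> ((d i / ?r + 2) * hits (U i) x (\<rho> k)) * cost s (d i) ?r"
      unfolding sum_distrib_right[symmetric]
      using U_spread d_pos[of i] by (intro mult_right_mono sum_hits_child cost_nonneg) auto
    also have "\<dots> = hits (U i) x (\<rho> k) * ((d i / ?r + 2) * cost s (d i) ?r)" by simp
    also have "\<dots> \<le> hits (U i) x (\<rho> k) * (real (N k) * (3 / 10) * cost s (d i) (\<rho> k))"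
    \<comment> \<open>Narrow sets contract; wide ones are not met at all because the load is below
      1, so both sides vanish.\<close>
    proof (cases "d i < \<rho> k")
      case True
      then show ?thesis
        by (intro mult_left_mono cost_children_decay hits_nonneg s N_powr \<rho>_pos \<rho>_Suc d_pos)
    next
      case False
      then show ?thesis using cover_hit_small[OF assms] by simp
    qed
    finally show "(\<Sum>j<N k. hits (U i) (x + real j * ?r) ?r * cost s (d i) ?r)
       \<le> real (N k) * (3 / 10) * (hits (U i) x (\<rho> k) * cost s (d i) (\<rho> k))" by (simp add: mult_ac)
  qed (intro summable_sum summable_mult cover_load_summable)+
  also have "\<dots> = real (N k) * (3 / 10) * cover_load k x"
    unfolding cover_load_def by (rule suminf_mult[OF cover_load_summable])
  finally show ?thesis .
qed

lemma strip_load_at_children: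
  assumes "0 < q" "0 < \<delta> q"
  shows "(\<Sum>j<N k. strip_load_at (Suc k) q (x + real j * \<rho> (Suc k)))
     \<le> (\<Sum>p\<in>{0..int q}. hits (strip \<delta> q p) x (\<rho> k)
          * ((2 * \<delta> q / real q / \<rho> (Suc k) + 2) * cost 1 (2 * \<delta> q / real q) (\<rho> (Suc k))))"
proof -
  let ?r = "\<rho> (Suc k)" and ?d = "2 * \<delta> q / real q"
  have "(\<Sum>j<N k. strip_load_at (Suc k) q (x + real j * ?r))
      = (\<Sum>p\<in>{0..int q}. (\<Sum>j<N k. hits (strip \<delta> q p) (x + real j * ?r) ?r) * cost 1 ?d ?r)"
    unfolding strip_load_at_def by (subst sum.swap) (simp add: sum_distrib_right)
  also have "\<dots> \<le> (\<Sum>p\<in>{0..int q}. ((?d / ?r + 2) * hits (strip \<delta> q p) x (\<rho> k)) * cost 1 ?d ?r)"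
    using assms by (intro sum_mono mult_right_mono cost_nonneg sum_hits_child strip_spread) auto
  finally show ?thesis by (simp add: mult_ac)
qed

text \<open>By \<open>\<delta>_lower\<close> the strip is at least as wide as a child. Either it is
  narrower than the parent and the linear contraction applies, or it is not met.\<close>

lemma strip_load_at_children_old:
  assumes "strip_load k x < 1" "q \<in> {Q 0..<Q k}"
  shows "(\<Sum>j<N k. strip_load_at (Suc k) q (x + real j * \<rho> (Suc k))) \<le> real (N k) * (3 / 10) * strip_load_at k q x"
proof -
  let ?r = "\<rho> (Suc k)" and ?d = "2 * \<delta> q / real q"
  have q: "0 < q" "0 < \<delta> q" using assms Q0 \<delta>_pos by auto
  have "(\<Sum>j<N k. strip_load_at (Suc k) q (x + real j * ?r))
     \<le> (\<Sum>p\<in>{0..int q}. hits (strip \<delta> q p) x (\<rho> k) * ((?d / ?r + 2) * cost 1 ?d ?r))"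
    by (rule strip_load_at_children[OF q])
  also have "\<dots> \<le> (\<Sum>p\<in>{0..int q}. hits (strip \<delta> q p) x (\<rho> k) * (real (N k) * (3 / 10) * cost 1 ?d (\<rho> k)))"
  proof (rule sum_mono)
    fix p assume p: "p \<in> {0..int q}"
    show "hits (strip \<delta> q p) x (\<rho> k) * ((?d / ?r + 2) * cost 1 ?d ?r)
       \<le> hits (strip \<delta> q p) x (\<rho> k) * (real (N k) * (3 / 10) * cost 1 ?d (\<rho> k))"
    proof (cases "?d < \<rho> k")
      case True
      moreover have "?r \<le> ?d" using \<delta>_lower[of q k] assms by (simp add: \<rho>_def)
      ultimately show ?thesis
        by (intro mult_left_mono cost_children_linear_old \<rho>_Suc \<rho>_pos hits_nonneg)
    next
      case False
      then show ?thesis using strip_hit_small[OF assms(1) _ assms(2) p] by simp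
    qed
  qed
  also have "\<dots> = real (N k) * (3 / 10) * strip_load_at k q x"
    by (simp add: strip_load_at_def sum_distrib_left mult_ac)
  finally show ?thesis .
qed

text \<open>About \<open>4 * q * \<rho> k\<close> strips are met, each charged
  \<open>30 * N k\<close> times its relative width \<open>2 * \<delta> q / (q * \<rho> k)\<close>;
  the product of the constants is 240.\<close>

lemma strip_load_at_children_new:
  assumes "q \<in> {Q k..<Q (Suc k)}"
  shows "(\<Sum>j<N k. strip_load_at (Suc k) q (x + real j * \<rho> (Suc k))) \<le> real (N k) * (240 * \<delta> q)"
proof -
  let ?r = "\<rho> (Suc k)" and ?d = "2 * \<delta> q / real q"
  have "Q 0 \<le> q" using assms monoD[OF Q_mono, of 0 k] by auto
  then have q: "0 < q" "0 < \<delta> q" using Q0 \<delta>_pos by auto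
  have q\<rho>: "1 \<le> real q * \<rho> k" using assms Q_pos[of k] by (simp add: \<rho>_def)
  have "(\<Sum>j<N k. strip_load_at (Suc k) q (x + real j * ?r))
     \<le> (\<Sum>p\<in>{0..int q}. hits (strip \<delta> q p) x (\<rho> k) * ((?d / ?r + 2) * cost 1 ?d ?r))"
    by (rule strip_load_at_children[OF q])
  also have "\<dots> = (\<Sum>p\<in>{0..int q}. hits (strip \<delta> q p) x (\<rho> k)) * ((?d / ?r + 2) * cost 1 ?d ?r)"
    by (simp add: sum_distrib_right)
  also have "\<dots> \<le> (4 * (real q * \<rho> k)) * (30 * real (N k) * (?d / \<rho> k))"
    using assms q q\<rho> \<rho>_pos[of k] \<rho>_pos[of "Suc k"] \<delta>_le_1[of k q] cost_nonneg
    by (intro mult_mono sum_hits_strips cost_children_linear_new \<rho>_Suc mult_nonneg_nonneg) auto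
  also have "\<dots> = real (N k) * (240 * \<delta> q)"
    using q \<rho>_pos[of k] by (simp add: field_simps)
  finally show ?thesis .
qed

lemma strip_load_children:
  assumes "strip_load k x < 1"
  shows "(\<Sum>j<N k. strip_load (Suc k) (x + real j * \<rho> (Suc k)))
     \<le> real (N k) * (3 / 10 * strip_load k x + 3 / 5)"
proof -
  let ?S = "\<lambda>q. \<Sum>j<N k. strip_load_at (Suc k) q (x + real j * \<rho> (Suc k))"
  have split: "{Q 0..<Q (Suc k)} = {Q 0..<Q k} \<union> {Q k..<Q (Suc k)}"
    using monoD[OF Q_mono, of 0 k] monoD[OF Q_mono, of k "Suc k"] by auto
  have "(\<Sum>j<N k. strip_load (Suc k) (x + real j * \<rho> (Suc k))) = (\<Sum>q\<in>{Q 0..<Q (Suc k)}. ?S q)"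
    unfolding strip_load_def by (rule sum.swap)
  also have "\<dots> = (\<Sum>q\<in>{Q 0..<Q k}. ?S q) + (\<Sum>q\<in>{Q k..<Q (Suc k)}. ?S q)"
    unfolding split by (rule sum.union_disjoint) auto
  also have "\<dots> \<le> (\<Sum>q\<in>{Q 0..<Q k}. real (N k) * (3 / 10) * strip_load_at k q x)
        + (\<Sum>q\<in>{Q k..<Q (Suc k)}. real (N k) * (240 * \<delta> q))"
    using strip_load_at_children_old[OF assms] strip_load_at_children_new by (intro add_mono sum_mono)
  also have "\<dots> = real (N k) * (3 / 10 * strip_load k x + 240 * (\<Sum>q\<in>{Q k..<Q (Suc k)}. \<delta> q))"
    by (simp add: strip_load_def sum_distrib_left distrib_left mult.assoc)
  \<comment> \<open>The budget 1/400 gives 240/400 = 3/5.\<close>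
  also have "\<dots> \<le> real (N k) * (3 / 10 * strip_load k x + 3 / 5)"
    using \<delta>_sum[of k] by (intro mult_left_mono) auto
  finally show ?thesis .
qed

text \<open>The average load of the children is below 3/10 + 3/5 = 9/10, so some child has load
  below 1.\<close>

lemma good_child:
  assumes "cover_load k x + strip_load k x < 1"
  obtains j where "j < N k"
    "cover_load (Suc k) (x + real j * \<rho> (Suc k)) + strip_load (Suc k) (x + real j * \<rho> (Suc k)) < 1"
proof -
  have "cover_load k x < 1" "strip_load k x < 1"
    using assms cover_load_nonneg[of k x] strip_load_nonneg[of k x] by auto
  note cover_load_children[OF this(1)] strip_load_children[OF this(2)]
  then have "(\<Sum>j<N k. cover_load (Suc k) (x + real j * \<rho> (Suc k)) + strip_load (Suc k) (x + real j * \<rho> (Suc k)))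
     \<le> real (N k) * (3 / 10 * (cover_load k x + strip_load k x) + 3 / 5)"
    unfolding sum.distrib by (simp add: algebra_simps)
  also have "\<dots> < real (N k) * 1"
  proof (rule mult_strict_left_mono)
    show "3 / 10 * (cover_load k x + strip_load k x) + 3 / 5 < 1" using assms by argo
    show "0 < real (N k)" using N_ge[of k] by simp
  qed
  finally show ?thesis using exists_less_of_sum_less that by blast
qed

lemma nested_intervals:
  obtains f where "\<And>k. cover_load k (f k) + strip_load k (f k) < 1" "f 0 = 0"
    "\<And>k. {f (Suc k)..f (Suc k) + \<rho> (Suc k)} \<subseteq> {f k..f k + \<rho> k}"
proof -
  \<comment> \<open>The clause for \<open>k = 0\<close> pins the first interval at the origin, which
    later places the limit point in [0, 1].\<close>
  have "\<exists>f. \<forall>k. ((cover_load k (f k) + strip_load k (f k) < 1) \<and> (k = 0 \<longrightarrow> f k = 0)) \<and>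
      {f (Suc k)..f (Suc k) + \<rho> (Suc k)} \<subseteq> {f k..f k + \<rho> k}"
  proof (rule dependent_nat_choice)
    show "\<exists>x. cover_load 0 x + strip_load 0 x < 1 \<and> ((0::nat) = 0 \<longrightarrow> x = 0)"
      using cover_load_initial by (simp add: strip_load_def)
  next
    fix x k assume "cover_load k x + strip_load k x < 1 \<and> (k = 0 \<longrightarrow> x = 0)"
    then obtain j where j: "j < N k"
      "cover_load (Suc k) (x + real j * \<rho> (Suc k)) + strip_load (Suc k) (x + real j * \<rho> (Suc k)) < 1"
      using good_child by blast
    have "real (Suc j) * \<rho> (Suc k) \<le> \<rho> k"
      unfolding \<rho>_Suc[of k] using j \<rho>_pos[of "Suc k"] by (intro mult_right_mono) auto
    moreover have "0 \<le> real j * \<rho> (Suc k)" using \<rho>_pos[of "Suc k"] by simp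
    ultimately have "{x + real j * \<rho> (Suc k)..x + real j * \<rho> (Suc k) + \<rho> (Suc k)} \<subseteq> {x..x + \<rho> k}"
      by (auto simp: algebra_simps)
    then show "\<exists>y. (cover_load (Suc k) y + strip_load (Suc k) y < 1 \<and> (Suc k = 0 \<longrightarrow> y = 0)) \<and>
        {y..y + \<rho> (Suc k)} \<subseteq> {x..x + \<rho> k}"
      using j by blast
  qed
  then show ?thesis using that by blast
qed

text \<open>The common point of the nested intervals works: every obstacle has positive width, hence
  is eventually wider than the current interval, and from then on a load below 1 forbids meeting
  it.\<close>

theorem avoiding_point:
  obtains \<beta> where "\<And>i. \<beta> \<notin> U i" "\<And>q. Q 0 \<le> q \<Longrightarrow> \<delta> q \<le> dist_nint (real q * \<beta>)"
proof -
  obtain f where f: "\<And>k. cover_load k (f k) + strip_load k (f k) < 1" "f 0 = 0"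
    and nest: "\<And>k. {f (Suc k)..f (Suc k) + \<rho> (Suc k)} \<subseteq> {f k..f k + \<rho> k}"
    using nested_intervals by blast
  have "\<Inter>(range (\<lambda>k. {f k..f k + \<rho> k})) \<noteq> {}"
    using \<rho>_pos less_imp_le lift_Suc_antimono_le[of "\<lambda>k. {f k..f k + \<rho> k}", OF nest]
    by (intro compact_nest) auto
  then obtain \<beta> where "\<beta> \<in> (\<Inter>k. {f k..f k + \<rho> k})" by blast
  then have \<beta>: "\<beta> \<in> {f k..f k + \<rho> k}" for k by blast
  have load: "cover_load k (f k) < 1" "strip_load k (f k) < 1" for k
    using f(1)[of k] cover_load_nonneg[of k "f k"] strip_load_nonneg[of k "f k"] by auto
  have \<rho>_small: "\<rho> k \<le> e" if "0 < e" "1 / e \<le> real k" for e k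
  proof -
    have "1 / e \<le> real (Q k)" using that Q_ge[of k] by linarith
    then show ?thesis using that Q_pos[of k] by (simp add: \<rho>_def field_simps)
  qed
  show ?thesis
  proof
    fix i show "\<beta> \<notin> U i"
    proof
      assume "\<beta> \<in> U i"
      obtain k :: nat where "1 / d i \<le> real k" using real_arch_simple by blast
      then have "hits (U i) (f k) (\<rho> k) = 0"
        using \<rho>_small d_pos by (intro cover_hit_small load) auto
      moreover have "\<beta> \<in> U i \<inter> {f k..f k + \<rho> k}" using \<beta>[of k] \<open>\<beta> \<in> U i\<close> by blast
      ultimately show False unfolding hits_def by auto
    qed
  next
    fix q assume q: "Q 0 \<le> q"
    have qpos: "0 < q" "0 < \<delta> q" using q Q0 \<delta>_pos[OF q] by linarith+
    show "\<delta> q \<le> dist_nint (real q * \<beta>)"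
    proof (rule ccontr)
      assume "\<not> ?thesis"
      then have strip: "\<beta> \<in> strip \<delta> q (round (real q * \<beta>))" by (simp add: strip_def dist_nint_def)
      \<comment> \<open>One \<open>k\<close> serves both purposes: the interval is no wider than the
        strip, and \<open>q < Q k\<close>, so the strip is already counted in the load.\<close>
      obtain k :: nat where k: "max (1 / (2 * \<delta> q / real q)) (real q + 1) \<le> real k"
        using real_arch_simple by blast
      have "\<rho> 0 \<le> 1" using Q0 by (simp add: \<rho>_def)
      then have "0 \<le> \<beta>" "\<beta> \<le> 1" using \<beta>[of 0] f(2) by auto
      then have "real_of_int 0 \<le> real q * \<beta>" "real q * \<beta> \<le> real_of_int (int q)"
        by (simp_all add: mult_left_le)
      from this[THEN round_mono] have p: "round (real q * \<beta>) \<in> {0..int q}" by simp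
      have "hits (strip \<delta> q (round (real q * \<beta>))) (f k) (\<rho> k) = 0"
      proof (rule strip_hit_small[OF load(2) _ _ p])
        show "\<rho> k \<le> 2 * \<delta> q / real q"
          by (rule \<rho>_small) (use k qpos in simp_all)
        have "real q < real k" using k by linarith
        then show "q \<in> {Q 0..<Q k}" using q Q_ge[of k] by simp
      qed
      moreover have "\<beta> \<in> strip \<delta> q (round (real q * \<beta>)) \<inter> {f k..f k + \<rho> k}"
        using \<beta>[of k] strip by blast
      ultimately show False unfolding hits_def by auto
    qed
  qed
qed

end

subsection \<open>Badly approximable numbers\<close>

lemma dist_nint_le: "dist_nint x \<le> \<bar>x - of_int n\<bar>"
  unfolding dist_nint_def by (rule round_diff_minimal)

lemma dist_nint_nonneg: "0 \<le> dist_nint x"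
  by (simp add: dist_nint_def)

lemma dist_nint_le_half: "dist_nint x \<le> 1 / 2"
  using of_int_round_abs_le[of x] by (simp add: dist_nint_def abs_minus_commute)

text \<open>The integral comparison in telescoping form: weighted AM-GM for
  \<open>y = n / (n + 1)\<close> bounds each term by the increment of
  \<open>n powr (1 - a) / (1 - a)\<close>.\<close>

lemma sum_powr_minus_le:
  fixes a :: real
  assumes "0 < a" "a < 1"
  shows "(\<Sum>j=1..n. real j powr (- a)) \<le> real n powr (1 - a) / (1 - a)"
proof (induction n)
  case (Suc n)
  show ?case
  proof (cases "n = 0")
    case True
    then show ?thesis using assms by simp
  next
    case False
    define y where "y = real n / real (Suc n)"
    have y: "0 < y" using False by (simp add: y_def)
    have "y powr (1 - a) * 1 powr a \<le> (1 - a) * y + a * 1"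
      using assms y by (intro Youngs_inequality_0) auto
    moreover have "(1 - a) * y + a = 1 - (1 - a) / real (Suc n)"
      by (simp add: y_def field_simps)
    ultimately have "y powr (1 - a) \<le> 1 - (1 - a) / real (Suc n)" by simp
    then have "real (Suc n) powr (1 - a) * y powr (1 - a)
        \<le> real (Suc n) powr (1 - a) * (1 - (1 - a) / real (Suc n))"
      by (intro mult_left_mono) auto
    moreover have "real (Suc n) powr (1 - a) * y powr (1 - a) = real n powr (1 - a)"
      by (simp add: y_def powr_divide)
    moreover have "real (Suc n) powr (1 - a) / real (Suc n) = real (Suc n) powr (- a)"
      using powr_diff[of "real (Suc n)" "1 - a" 1] by simp
    then have "real (Suc n) powr (1 - a) * ((1 - a) / real (Suc n)) = (1 - a) * real (Suc n) powr (- a)"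
      by (metis mult.commute times_divide_eq_right)
    ultimately have "(1 - a) * real (Suc n) powr (- a) \<le> real (Suc n) powr (1 - a) - real n powr (1 - a)"
      by (simp add: right_diff_distrib)
    then have "real (Suc n) powr (- a) \<le> real (Suc n) powr (1 - a) / (1 - a) - real n powr (1 - a) / (1 - a)"
      using assms by (simp add: pos_le_divide_eq mult.commute flip: diff_divide_distrib)
    then show ?thesis using Suc by simp
  qed
qed simp

lemma dyadic_shell:
  fixes x :: real
  assumes "0 < x" "x \<le> 1 / 2"
  obtains j :: nat where "1 \<le> j" "(1 / 2) ^ Suc j < x" "x \<le> (1 / 2) ^ j"
proof -
  obtain n :: nat where n: "(1 / 2) ^ n < x" using real_arch_pow_inv[of x "1 / 2"] assms by auto
  define i where "i = (LEAST n. (1 / 2 :: real) ^ n < x)"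
  have i: "(1 / 2) ^ i < x" unfolding i_def by (rule LeastI[of _ n]) (rule n)
  have "i \<noteq> 0" using i assms by (intro notI) simp
  moreover have "i \<noteq> 1" using i assms by (intro notI) simp
  ultimately obtain j where j: "i = Suc j" "1 \<le> j" by (cases i) auto
  have "\<not> (1 / 2) ^ j < x" using not_less_Least[of j "\<lambda>n. (1 / 2 :: real) ^ n < x"] j by (simp flip: i_def)
  then show ?thesis using that[of j] j i by auto
qed

locale badly_approximable =
  fixes \<alpha> \<gamma> a :: real
  assumes \<gamma>_pos: "0 < \<gamma>"
    and bad: "\<And>q::nat. 1 \<le> q \<Longrightarrow> \<gamma> \<le> real q * dist_nint (real q * \<alpha>)"
    and a: "0 < a" "a < 1"
begin

abbreviation nrm :: "nat \<Rightarrow> real" where "nrm q \<equiv> dist_nint (real q * \<alpha>)"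

lemma nrm_pos: "1 \<le> q \<Longrightarrow> 0 < nrm q"
  using bad[of q] \<gamma>_pos dist_nint_nonneg[of "real q * \<alpha>"] by (cases "nrm q = 0") auto

text \<open>Pigeonhole: for distinct \<open>q\<close>, \<open>q'\<close> in the range the signed
  residues \<open>r\<close> differ by at least \<open>nrm\<close> of the difference, hence by more
  than \<open>\<gamma> / M\<close>. Cells of length \<open>\<gamma> / M\<close> thus hold at most
  one residue each, and all residues lie in \<open>[-t, t]\<close>.\<close>

lemma card_small_nrm:
  fixes M :: nat and t :: real
  assumes "1 \<le> M" "0 \<le> t"
  shows "real (card {q\<in>{M..<2 * M}. nrm q \<le> t}) \<le> 2 * t * real M / \<gamma> + 2"
proof -
  let ?S = "{q\<in>{M..<2 * M}. nrm q \<le> t}"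
  define r where "r q = real q * \<alpha> - of_int (round (real q * \<alpha>))" for q :: nat
  define g where "g q = \<lfloor>r q * (real M / \<gamma>)\<rfloor>" for q
  have M: "0 < real M / \<gamma>" using assms \<gamma>_pos by simp
  have sep: "1 < \<bar>r q - r q'\<bar> * (real M / \<gamma>)" if "q' < q" "q \<in> ?S" "q' \<in> ?S" for q q'
  proof -
    have "real (q - q') < real M" "1 \<le> q - q'" using that by auto
    have "\<gamma> \<le> real (q - q') * nrm (q - q')" by (rule bad) fact
    also have "\<dots> < real M * nrm (q - q')"
      using \<open>real (q - q') < real M\<close> nrm_pos[OF \<open>1 \<le> q - q'\<close>] by simp
    also have "nrm (q - q') \<le> \<bar>r q - r q'\<bar>"
      using dist_nint_le[of "real (q - q') * \<alpha>" "round (real q * \<alpha>) - round (real q' * \<alpha>)"] that(1)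
      by (simp add: r_def of_nat_diff algebra_simps)
    finally show ?thesis using \<gamma>_pos assms by (simp add: field_simps)
  qed
  have inj': "g q \<noteq> g q'" if "q' < q" "q \<in> ?S" "q' \<in> ?S" for q q'
  proof
    assume "g q = g q'"
    then have "\<bar>r q * (real M / \<gamma>) - r q' * (real M / \<gamma>)\<bar> < 1"
      unfolding g_def by linarith
    then have "\<bar>r q - r q'\<bar> * (real M / \<gamma>) < 1"
      using M by (simp only: abs_mult abs_of_pos flip: left_diff_distrib)
    then show False using sep[OF that] by linarith
  qed
  then have inj: "inj_on g ?S"
    unfolding inj_on_def by (metis (no_types, lifting) linorder_neqE_nat)
  have "real (card (g ` ?S)) \<le> (2 * t * real M / \<gamma> + 1) + 1"
  proof (rule card_le_of_spread)
    fix i j assume "i \<in> g ` ?S" "j \<in> g ` ?S"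
    then obtain q q' where q: "i = g q" "j = g q'" "nrm q \<le> t" "nrm q' \<le> t" by auto
    then have "r q' - r q \<le> 2 * t" unfolding dist_nint_def r_def by linarith
    then have "(r q' - r q) * (real M / \<gamma>) \<le> 2 * t * (real M / \<gamma>)"
      using M by (intro mult_right_mono) auto
    then have "r q' * (real M / \<gamma>) - r q * (real M / \<gamma>) \<le> 2 * t * real M / \<gamma>"
      by (simp add: left_diff_distrib diff_divide_distrib)
    then show "real_of_int (j - i) \<le> 2 * t * real M / \<gamma> + 1"
      unfolding q g_def of_int_diff by linarith
  qed (use assms \<gamma>_pos in auto)
  then show ?thesis using card_image[OF inj] by simp
qed

section \<open>The weight and sums of its reciprocal\<close>

definition weight :: "nat \<Rightarrow> real" where
  "weight q = real q * ln (real q) powr (2 - a) * ln (1 / nrm q) powr a * nrm q"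

lemma ln_inverse_nrm_pos:
  assumes "1 \<le> q"
  shows "0 < ln (1 / nrm q)"
  using nrm_pos[OF assms] dist_nint_le_half[of "real q * \<alpha>"] by (intro ln_gt_zero) (simp add: field_simps)

text \<open>At \<open>q = 1\<close> the weight is 0, since \<open>ln 1 = 0\<close>.\<close>

lemma weight_pos:
  assumes "2 \<le> q"
  shows "0 < weight q"
  using assms nrm_pos[of q] ln_inverse_nrm_pos[of q] by (simp add: weight_def)

text \<open>A crude bound from \<open>ln y \<le> y\<close> for both logarithms; it serves to show
  that strips are not too thin.\<close>

lemma weight_le:
  assumes "2 \<le> q"
  shows "weight q \<le> real q ^ 3"
proof -
  let ?x = "nrm q"
  have x: "0 < ?x" "?x \<le> 1 / 2" using assms nrm_pos[of q] dist_nint_le_half by auto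
  have "ln (1 / ?x) powr a \<le> (1 / ?x) powr a"
    using x a ln_inverse_nrm_pos[of q] ln_le_minus_one[of "1 / ?x"] assms
    by (intro powr_mono2) auto
  also have "\<dots> \<le> (1 / ?x) powr 1" using x a by (intro powr_mono) (auto simp: field_simps)
  finally have "ln (1 / ?x) powr a * ?x \<le> 1 / ?x * ?x" using x by (intro mult_right_mono) auto
  then have 1: "ln (1 / ?x) powr a * ?x \<le> 1" using x by simp
  have "ln (real q) powr (2 - a) \<le> real q powr (2 - a)"
    using assms a ln_le_minus_one[of "real q"] by (intro powr_mono2) auto
  also have "\<dots> \<le> real q powr 2" using assms a by (intro powr_mono) auto
  finally have 2: "ln (real q) powr (2 - a) \<le> real q ^ 2" using assms by simp
  have "weight q = (real q * ln (real q) powr (2 - a)) * (ln (1 / ?x) powr a * ?x)"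
    by (simp add: weight_def)
  also have "\<dots> \<le> (real q * real q ^ 2) * 1"
    using 1 2 x by (intro mult_mono) auto
  finally show ?thesis by (simp add: power3_eq_cube power2_eq_square)
qed

text \<open>Each factor of the weight is bounded below on the shell. The exponents
  \<open>2 - a\<close> and \<open>a\<close> combine to \<open>(ln 2) ^ 2\<close>; the leading 2
  comes from the lower end \<open>(1 / 2) ^ Suc j\<close>.\<close>

lemma inverse_weight_le_shell:
  assumes m: "1 \<le> m" and q: "2 ^ m \<le> q" and j: "1 \<le> j" "(1 / 2) ^ Suc j < nrm q" "nrm q \<le> (1 / 2) ^ j"
  shows "1 / weight q \<le> 2 * 2 ^ j / (2 ^ m * (ln 2) ^ 2 * real m powr (2 - a) * real j powr a)"
proof -
  have "(2::nat) ^ 1 \<le> 2 ^ m" using m by (intro power_increasing) auto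
  then have q2: "2 \<le> q" using q by simp
  have qr: "2 ^ m \<le> real q" using q by (metis of_nat_le_iff of_nat_numeral of_nat_power)
  have "ln (2 ^ m) \<le> ln (real q)" using qr q2 by (intro ln_mono) auto
  then have 1: "real m * ln 2 \<le> ln (real q)" by (simp add: ln_realpow)
  have npos: "0 < nrm q" using q2 by (intro nrm_pos) simp
  have "ln (2 ^ j) \<le> ln (1 / nrm q)"
    using j npos by (intro ln_mono) (auto simp: field_simps power_divide)
  then have 2: "real j * ln 2 \<le> ln (1 / nrm q)" by (simp add: ln_realpow)
  have "2 ^ m * (real m * ln 2) powr (2 - a) * (real j * ln 2) powr a * (1 / 2) ^ Suc j \<le> weight q"
    unfolding weight_def using qr 1 2 a j npos
    by (intro mult_mono powr_mono2) auto
  moreover have "(real m * ln 2) powr (2 - a) * (real j * ln 2) powr a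
      = (ln 2) ^ 2 * real m powr (2 - a) * real j powr a"
  proof -
    have "ln 2 powr (2 - a) * ln 2 powr a = (ln 2 :: real) powr 2" by (simp flip: powr_add)
    then have "ln 2 powr (2 - a) * ln 2 powr a = (ln 2 :: real) ^ 2" by simp
    then show ?thesis by (simp add: powr_mult mult_ac)
  qed
  ultimately have "(2 ^ m * (ln 2) ^ 2 * real m powr (2 - a) * real j powr a) * (1 / 2) ^ Suc j \<le> weight q"
    by (simp add: mult_ac)
  moreover have "0 < (2 ^ m * (ln 2) ^ 2 * real m powr (2 - a) * real j powr a) * (1 / 2 :: real) ^ Suc j"
    using m j by simp
  ultimately have "1 / weight q \<le> 1 / ((2 ^ m * (ln 2) ^ 2 * real m powr (2 - a) * real j powr a) * (1 / 2) ^ Suc j)"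
    using weight_pos[OF q2] by (intro divide_left_mono) (auto intro: mult_pos_pos)
  then show ?thesis by (simp add: power_divide mult_ac)
qed

text \<open>The shell count cancels \<open>2 ^ j / 2 ^ m\<close>, leaving
  \<open>m powr (a - 2)\<close> times a sum of \<open>j powr (- a)\<close>, which is of order
  \<open>m powr (1 - a)\<close>.\<close>

lemma inverse_weight_dyadic_sum:
  obtains C where "0 < C" "\<And>m. 1 \<le> m \<Longrightarrow> (\<Sum>q\<in>{2 ^ m..<2 ^ Suc m}. 1 / weight q) \<le> C / real m"
proof -
  \<comment> \<open>Bad approximability through \<open>g\<close> limits the shells that occur to
    \<open>j \<le> m + g\<close>. In \<open>K\<close>, the part \<open>2 / \<gamma>\<close> is the
    main count and \<open>2 ^ (g + 2)\<close> absorbs the additive 2 of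
    \<open>card_small_nrm\<close>.\<close>
  obtain g :: nat where g: "(1 / 2) ^ g < \<gamma>" using real_arch_pow_inv[of \<gamma> "1 / 2"] \<gamma>_pos by auto
  define K where "K = 2 / \<gamma> + 2 ^ (g + 2)"
  define C where "C = 2 * K * (2 + real g) / ((ln 2) ^ 2 * (1 - a))"
  have K: "0 < K" using \<gamma>_pos by (simp add: K_def add_pos_pos)
  show ?thesis
  proof (rule that[of C])
    show "0 < C" using K a by (simp add: C_def)
    fix m :: nat assume m: "1 \<le> m"
    let ?J = "{1..m + 1 + g}" and ?S = "{2 ^ m..<2 ^ Suc m} :: nat set"
    define B where "B j = 2 * 2 ^ j / (2 ^ m * (ln 2) ^ 2 * real m powr (2 - a) * real j powr a)" for j :: nat
    have B: "0 \<le> B j" for j by (simp add: B_def)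
    \<comment> \<open>The indicator keeps only the upper end of the shell; the overcount is
      harmless, and \<open>card_small_nrm\<close> counts exactly such sets.\<close>
    have pt: "1 / weight q \<le> (\<Sum>j\<in>?J. of_bool (nrm q \<le> (1 / 2) ^ j) * B j)" if q: "q \<in> ?S" for q
    proof -
      have q1: "1 \<le> q" using q by (simp add: le_trans[of 1 "2 ^ m"])
      then obtain j where j: "1 \<le> j" "(1 / 2) ^ Suc j < nrm q" "nrm q \<le> (1 / 2) ^ j"
        using dyadic_shell nrm_pos dist_nint_le_half by blast
      have "real q < 2 ^ Suc m" using q by (metis atLeastLessThan_iff of_nat_less_iff of_nat_numeral of_nat_power)
      have "(1 / 2) ^ g < real q * nrm q" using g bad[OF q1] by linarith
      also have "\<dots> \<le> 2 ^ Suc m * nrm q"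
        using \<open>real q < 2 ^ Suc m\<close> dist_nint_nonneg by (intro mult_right_mono) auto
      also have "\<dots> \<le> 2 ^ Suc m * (1 / 2) ^ j" using j by (intro mult_left_mono) auto
      finally have "(2::real) ^ j < 2 ^ (Suc m + g)"
        by (simp add: field_simps power_divide power_add)
      then have "j < Suc m + g" by (rule power_less_imp_less_exp[rotated]) simp
      then have "j \<in> ?J" using j by simp
      have "1 / weight q \<le> of_bool (nrm q \<le> (1 / 2) ^ j) * B j"
        unfolding B_def using inverse_weight_le_shell[OF m _ j] q j by simp
      also have "\<dots> \<le> (\<Sum>j\<in>?J. of_bool (nrm q \<le> (1 / 2) ^ j) * B j)"
        using \<open>j \<in> ?J\<close> B by (intro member_le_sum) auto
      finally show ?thesis .
    qed
    have shell: "real (card {q\<in>?S. nrm q \<le> (1 / 2) ^ j}) * B j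
        \<le> 2 * K / ((ln 2) ^ 2 * real m powr (2 - a)) * real j powr (- a)" if j: "j \<in> ?J" for j
    proof -
      have "(2::real) ^ j \<le> 2 ^ (m + 1 + g)" using j by (intro power_increasing) auto
      then have "2 \<le> 2 ^ (g + 2) * (2 ^ m / 2 ^ j :: real)" by (simp add: field_simps power_add)
      moreover have "real (card {q\<in>?S. nrm q \<le> (1 / 2) ^ j}) \<le> 2 * (1 / 2) ^ j * real (2 ^ m) / \<gamma> + 2"
        using card_small_nrm[of "2 ^ m" "(1 / 2) ^ j"] by simp
      ultimately have "real (card {q\<in>?S. nrm q \<le> (1 / 2) ^ j}) \<le> K * (2 ^ m / 2 ^ j)"
        by (simp add: K_def algebra_simps power_divide)
      then have "real (card {q\<in>?S. nrm q \<le> (1 / 2) ^ j}) * B j \<le> K * (2 ^ m / 2 ^ j) * B j"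
        using B by (intro mult_right_mono)
      also have "\<dots> = 2 * K / ((ln 2) ^ 2 * real m powr (2 - a)) * real j powr (- a)"
        by (simp add: B_def powr_minus divide_simps)
      finally show ?thesis .
    qed
    have "(\<Sum>q\<in>?S. 1 / weight q) \<le> (\<Sum>q\<in>?S. \<Sum>j\<in>?J. of_bool (nrm q \<le> (1 / 2) ^ j) * B j)"
      by (intro sum_mono pt)
    also have "\<dots> = (\<Sum>j\<in>?J. (\<Sum>q\<in>?S. of_bool (nrm q \<le> (1 / 2) ^ j)) * B j)"
      by (subst sum.swap) (simp add: sum_distrib_right)
    also have "\<dots> = (\<Sum>j\<in>?J. real (card {q\<in>?S. nrm q \<le> (1 / 2) ^ j}) * B j)"
      by (intro sum.cong refl arg_cong2[of _ _ _ _ "(*)"]) (simp add: Int_def)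
    also have "\<dots> \<le> (\<Sum>j\<in>?J. 2 * K / ((ln 2) ^ 2 * real m powr (2 - a)) * real j powr (- a))"
      by (intro sum_mono shell)
    also have "\<dots> = 2 * K / ((ln 2) ^ 2 * real m powr (2 - a)) * (\<Sum>j\<in>?J. real j powr (- a))"
      by (simp only: sum_distrib_left)
    also have "\<dots> \<le> 2 * K / ((ln 2) ^ 2 * real m powr (2 - a)) * ((2 + real g) * real m powr (1 - a) / (1 - a))"
    proof (rule mult_left_mono)
      have "real (m + 1 + g) \<le> (2 + real g) * real m"
        using m mult_left_mono[of 1 "real m" "1 + real g"] by (simp add: algebra_simps)
      then have "real (m + 1 + g) powr (1 - a) \<le> ((2 + real g) * real m) powr (1 - a)"
        using a by (intro powr_mono2) auto
      also have "\<dots> = (2 + real g) powr (1 - a) * real m powr (1 - a)" by (rule powr_mult)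
      also have "\<dots> \<le> (2 + real g) powr 1 * real m powr (1 - a)"
        using a by (intro mult_right_mono powr_mono) auto
      finally have "real (m + 1 + g) powr (1 - a) / (1 - a) \<le> (2 + real g) * real m powr (1 - a) / (1 - a)"
        using a by (intro divide_right_mono) auto
      then show "(\<Sum>j\<in>?J. real j powr (- a)) \<le> (2 + real g) * real m powr (1 - a) / (1 - a)"
        using sum_powr_minus_le[OF a, of "m + 1 + g"] by linarith
    qed (use K in simp)
    also have "\<dots> = C * (real m powr (1 - a) / real m powr (2 - a))" by (simp add: C_def mult_ac)
    also have "real m powr (1 - a) / real m powr (2 - a) = 1 / real m"
      using m by (simp add: powr_minus_divide flip: powr_diff)
    finally show "(\<Sum>q\<in>?S. 1 / weight q) \<le> C / real m" by simp
  qed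
qed

text \<open>The block consists of \<open>4 * n\<close> dyadic ranges, each contributing at most
  \<open>C / n\<close>, so the bound does not depend on \<open>n\<close>.\<close>

lemma inverse_weight_block_sum:
  obtains C where "0 < C" "\<And>n. 1 \<le> n \<Longrightarrow> (\<Sum>q\<in>{2 ^ n..<2 ^ (5 * n)}. 1 / weight q) \<le> C"
proof -
  obtain C where C: "0 < C" "\<And>m. 1 \<le> m \<Longrightarrow> (\<Sum>q\<in>{2 ^ m..<2 ^ Suc m}. 1 / weight q) \<le> C / real m"
    using inverse_weight_dyadic_sum by blast
  have step: "(\<Sum>q\<in>{2 ^ n..<2 ^ (n + l)}. 1 / weight q) \<le> real l * (C / real n)" if n: "1 \<le> n" for n l
  proof (induction l)
    case (Suc l)
    have "(2::nat) ^ n \<le> 2 ^ (n + l)" "(2::nat) ^ (n + l) \<le> 2 ^ Suc (n + l)"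
      by (intro power_increasing; simp)+
    then have "(\<Sum>q\<in>{2 ^ n..<2 ^ (n + Suc l)}. 1 / weight q)
        = (\<Sum>q\<in>{2 ^ n..<2 ^ (n + l)}. 1 / weight q) + (\<Sum>q\<in>{2 ^ (n + l)..<2 ^ Suc (n + l)}. 1 / weight q)"
      using sum.atLeastLessThan_concat[of "2 ^ n" "2 ^ (n + l)" "2 ^ Suc (n + l)" "\<lambda>q. 1 / weight q"] by simp
    also have "\<dots> \<le> real l * (C / real n) + C / real (n + l)"
      using Suc C(2)[of "n + l"] n by (intro add_mono) auto
    also have "C / real (n + l) \<le> C / real n"
      using C n by (intro divide_left_mono) auto
    finally show ?case unfolding of_nat_Suc distrib_right by simp
  qed simp
  show ?thesis
  proof (rule that[of "4 * C"])
    show "(\<Sum>q\<in>{2 ^ n..<2 ^ (5 * n)}. 1 / weight q) \<le> 4 * C" if n: "1 \<le> n" for n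
    proof -
      have "n + 4 * n = 5 * n" by simp
      then show ?thesis using step[OF n, of "4 * n"] n by simp
    qed
  qed (use C in simp)
qed

end

subsection \<open>Hausdorff measure\<close>

lemma harmonic_cover_nonneg:
  fixes c x :: real
  assumes "0 < c" "0 \<le> x"
  obtains i where "c * harm i \<le> x" "x \<le> c * harm (Suc i)"
proof -
  have "eventually (\<lambda>n. x / c \<le> harm n) sequentially"
    using harm_at_top by (auto simp: filterlim_at_top)
  then obtain n where "x / c \<le> harm n" by (meson eventually_happens sequentially_bot)
  then have n: "x \<le> c * harm n" using assms by (simp add: field_simps)
  define m where "m = (LEAST n. x \<le> c * harm n)"
  have m: "x \<le> c * harm m" unfolding m_def by (rule LeastI[of _ n]) (rule n)
  show ?thesis
  proof (cases m)
    case 0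
    then have "x = 0" using m assms by (simp add: harm_expand)
    then show ?thesis using that[of 0] assms by (simp add: harm_expand)
  next
    case (Suc i)
    have "\<not> x \<le> c * harm i" using not_less_Least[of i "\<lambda>n. x \<le> c * harm n"] Suc by (simp flip: m_def)
    then show ?thesis using that[of i] m Suc by simp
  qed
qed

lemma hausdorff_pre_le:
  assumes "E \<subseteq> (\<Union>i. U i)" "\<And>i. bounded (U i)" "\<And>i. diameter (U i) \<le> \<delta>"
  shows "hausdorff_pre s \<delta> E \<le> (\<Sum>i. ennreal (diameter (U i) powr s))"
  unfolding hausdorff_pre_def using assms by (intro INF_lower) auto

text \<open>Intervals of lengths \<open>c / n\<close>, laid end to end in both directions, cover the line because
  the harmonic series diverges, while their total \<open>s\<close>-cost is \<open>O(c\<^sup>s)\<close>.\<close>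
lemma hausdorff_measure_eq_0:
  assumes "1 < s"
  shows "hausdorff_measure s E = 0"
proof -
  define Z where "Z = (\<Sum>i. real (Suc i) powr - s)"
  have summ: "summable (\<lambda>i. real (Suc i) powr - s)"
    using assms by (subst summable_Suc_iff) (simp add: summable_real_powr_iff)
  have Z: "0 < Z" unfolding Z_def using summ by (intro suminf_pos) auto
  have pre_le: "hausdorff_pre s \<delta> E \<le> ennreal e" if "0 < \<delta>" "0 < e" for \<delta> e
  proof -
    \<comment> \<open>The minimum serves the diameter bound \<open>2 * c \<le> \<delta>\<close> and
      the cost bound \<open>(2 * c) powr s * Z \<le> e\<close>.\<close>
    define c where "c = min \<delta> ((e / Z) powr (1 / s)) / 2"
    have c: "0 < c" "2 * c \<le> \<delta>" using that Z by (auto simp: c_def)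
    have "(2 * c) powr s \<le> ((e / Z) powr (1 / s)) powr s"
      using assms c by (intro powr_mono2) (auto simp: c_def)
    also have "\<dots> = e / Z" using assms that Z by (simp add: powr_powr)
    finally have cs: "(2 * c) powr s * Z \<le> e" using Z by (simp add: field_simps)
    \<comment> \<open>Even indices tile the nonnegative half-line and odd ones its mirror image; the
      halved index is the source of the 2 in \<open>2 * c\<close>.\<close>
    define U where "U i = (if even i then {c * harm (i div 2)..c * harm (Suc (i div 2))}
        else {- (c * harm (Suc (i div 2)))..- (c * harm (i div 2))})" for i :: nat
    have "diameter (U i) = c / real (Suc (i div 2))" for i
    proof -
      have "c * harm (Suc (i div 2)) - c * harm (i div 2) = c / real (Suc (i div 2))"
        by (simp add: harm_Suc divide_inverse algebra_simps)
      moreover have "0 \<le> c / real (Suc (i div 2))" using c by simp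
      ultimately show ?thesis unfolding U_def by (auto simp del: of_nat_Suc)
    qed
    moreover have "c / real (Suc (i div 2)) \<le> 2 * c / real (Suc i)" for i
    proof -
      have "Suc i \<le> 2 * Suc (i div 2)" by simp
      then have "real (Suc i) \<le> 2 * real (Suc (i div 2))" by linarith
      then have "c * real (Suc i) \<le> c * (2 * real (Suc (i div 2)))" using c by (intro mult_left_mono) auto
      then show ?thesis by (simp add: divide_simps mult_ac del: of_nat_Suc)
    qed
    ultimately have diam: "diameter (U i) \<le> 2 * c / real (Suc i)" for i by simp
    have bdd: "bounded (U i)" for i by (simp add: U_def)
    have "hausdorff_pre s \<delta> E \<le> (\<Sum>i. ennreal (diameter (U i) powr s))"
    proof (rule hausdorff_pre_le[OF _ bdd])
      show "E \<subseteq> (\<Union>i. U i)"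
      proof
        fix x
        show "x \<in> (\<Union>i. U i)"
        proof (cases "0 \<le> x")
          case True
          then obtain i where "c * harm i \<le> x" "x \<le> c * harm (Suc i)"
            using harmonic_cover_nonneg c by blast
          then have "x \<in> U (2 * i)" by (simp add: U_def)
          then show ?thesis by blast
        next
          case False
          then obtain i where "c * harm i \<le> - x" "- x \<le> c * harm (Suc i)"
            using harmonic_cover_nonneg[of c "- x"] c by auto
          then have "x \<in> U (Suc (2 * i))" by (simp add: U_def)
          then show ?thesis by blast
        qed
      qed
      show "diameter (U i) \<le> \<delta>" for i
      proof -
        have "2 * c / real (Suc i) \<le> 2 * c / 1" using c by (intro divide_left_mono) auto
        then show ?thesis using diam[of i] c by linarith
      qed
    qed
    also have "\<dots> \<le> (\<Sum>i. ennreal ((2 * c) powr s * real (Suc i) powr - s))"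
    proof (intro suminf_le summableI ennreal_leI)
      fix i
      have "diameter (U i) powr s \<le> (2 * c / real (Suc i)) powr s"
        using assms diam[of i] diameter_ge_0[OF bdd] by (intro powr_mono2) auto
      also have "\<dots> = (2 * c) powr s * real (Suc i) powr - s"
        using c by (simp add: powr_divide powr_minus_divide)
      finally show "diameter (U i) powr s \<le> (2 * c) powr s * real (Suc i) powr - s" .
    qed
    also have "\<dots> = ennreal ((2 * c) powr s * Z)"
      unfolding Z_def suminf_mult[OF summ, symmetric]
      by (intro suminf_ennreal2 summable_mult summ) simp
    also have "\<dots> \<le> ennreal e" using cs by (rule ennreal_leI)
    finally show ?thesis .
  qed
  have "hausdorff_pre s \<delta> E \<le> 0" if "0 < \<delta>" for \<delta>
    by (rule ennreal_le_epsilon) (use that pre_le in simp)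
  then have "hausdorff_measure s E \<le> 0" unfolding hausdorff_measure_def by (intro SUP_least) simp
  then show ?thesis by simp
qed

text \<open>Enlarging each set by a summable amount makes all the sizes positive, so that sets of
  diameter \<open>0\<close> need no separate treatment.\<close>
lemma hausdorff_measure_0_cover:
  assumes "hausdorff_measure s E = 0" "0 < s" "0 < \<eta>"
  obtains U d where "E \<subseteq> (\<Union>i. U i)" "\<And>i. 0 < (d i :: real)"
    "\<And>i y z. y \<in> U i \<Longrightarrow> z \<in> U i \<Longrightarrow> \<bar>y - z\<bar> \<le> d i"
    "summable (\<lambda>i. d i powr s)" "(\<Sum>i. d i powr s) < \<eta>"
proof -
  have "hausdorff_pre s 1 E \<le> hausdorff_measure s E"
    unfolding hausdorff_measure_def by (rule SUP_upper) simp
  then have "hausdorff_pre s 1 E < ennreal (\<eta> / 2)" using assms by simp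
  then obtain U where U: "E \<subseteq> (\<Union>i. U i)" "\<And>i. bounded (U i)"
    "(\<Sum>i. ennreal (diameter (U i) powr s)) < ennreal (\<eta> / 2)"
    unfolding hausdorff_pre_def INF_less_iff by auto
  have nt: "(\<Sum>i. ennreal (diameter (U i) powr s)) \<noteq> top" using U(3) by auto
  have summ: "summable (\<lambda>i. diameter (U i) powr s)"
    by (rule summable_suminf_not_top[OF _ nt]) simp
  have "ennreal (\<Sum>i. diameter (U i) powr s) < ennreal (\<eta> / 2)"
    using U(3) by (subst (asm) suminf_ennreal2[OF _ summ]) auto
  then have less: "(\<Sum>i. diameter (U i) powr s) < \<eta> / 2"
    using assms by (simp add: ennreal_less_iff suminf_nonneg[OF summ])
  \<comment> \<open>The enlargement is made on the \<open>s\<close>-th powers, so that it adds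
    exactly \<open>\<eta> / 2\<close> to the total cost.\<close>
  define d where "d i = (diameter (U i) powr s + \<eta> / 2 * (1 / 2) ^ Suc i) powr (1 / s)" for i
  have pos: "0 < diameter (U i) powr s + \<eta> / 2 * (1 / 2) ^ Suc i" for i
    using assms by (intro add_nonneg_pos) auto
  have d_powr: "d i powr s = diameter (U i) powr s + \<eta> / 2 * (1 / 2) ^ Suc i" for i
    using assms pos[of i] by (simp add: d_def powr_powr)
  have "(\<lambda>i. \<eta> / 2 * (1 / 2) ^ Suc i) sums (\<eta> / 2 * 1)" by (intro sums_mult power_half_series)
  then have sums: "(\<lambda>i. d i powr s) sums ((\<Sum>i. diameter (U i) powr s) + \<eta> / 2)"
    unfolding d_powr using summ by (auto intro!: sums_add summable_sums)
  have d_pos: "0 < d i" for i using pos[of i] by (simp add: d_def)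
  have "\<bar>y - z\<bar> \<le> d i" if "y \<in> U i" "z \<in> U i" for i y z
  proof -
    have "\<bar>y - z\<bar> \<le> diameter (U i)"
      using diameter_bounded_bound[OF U(2) that] by (simp add: dist_real_def)
    also have "\<dots> = (diameter (U i) powr s) powr (1 / s)"
      using assms diameter_ge_0[OF U(2)[of i]] by (simp add: powr_powr)
    also have "\<dots> \<le> d i" unfolding d_def using assms by (intro powr_mono2) auto
    finally show ?thesis .
  qed
  then show ?thesis
    using that[of U d] U(1) d_pos sums less by (auto simp: sums_iff)
qed

section \<open>Lower bound for the measure, and the dimension\<close>

context badly_approximable
begin

text \<open>Measure zero would give a cheap cover, and the obstacle course run against that cover
  yields a point of the set outside it.\<close>

lemma hausdorff_measure_ne_0:
  assumes s: "0 < s" "s < 1"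
  shows "hausdorff_measure s
     {\<beta>. liminf (\<lambda>q. ereal (weight q * dist_nint (real q * \<beta>))) > 0} \<noteq> 0" (is "hausdorff_measure s ?E \<noteq> 0")
proof
  assume zero: "hausdorff_measure s ?E = 0"
  obtain C where C: "0 < C" "\<And>n. 1 \<le> n \<Longrightarrow> (\<Sum>q\<in>{2 ^ n..<2 ^ (5 * n)}. 1 / weight q) \<le> C"
    using inverse_weight_block_sum by blast
  define c where "c = 1 / (400 * C)"
  have c: "0 < c" using C by (simp add: c_def)
  \<comment> \<open>The three bounds yield \<open>2 \<le> Q k\<close>,
    \<open>10 \<le> N k powr (1 - s)\<close> and \<open>1 \<le> 2 * c * Q k\<close>.\<close>
  obtain n :: nat where n: "max 2 (max (10 powr (1 / (1 - s))) (1 / (2 * c))) < 2 ^ n"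
    using real_arch_pow[of 2 "max 2 (max (10 powr (1 / (1 - s))) (1 / (2 * c)))"] by auto
  then have n1: "1 \<le> n" by (cases n) auto
  define Q where "Q k = (2::nat) ^ (n * 5 ^ k)" for k
  define N where "N k = Q k ^ 4" for k
  have Q_ge: "2 ^ n \<le> Q k" for k unfolding Q_def by (intro power_increasing) auto
  have Q_ge_real: "2 ^ n \<le> real (Q k)" for k
    using Q_ge[of k] by (metis of_nat_le_iff of_nat_numeral of_nat_power)
  have Q_ge_2: "2 \<le> Q k" for k
  proof -
    have "2 \<le> real (Q k)" using Q_ge_real[of k] n by linarith
    then show ?thesis by simp
  qed
  note Q0 = Q_ge_2[of 0]
  have Q_Suc: "Q (Suc k) = N k * Q k" for k
    by (simp add: Q_def N_def flip: power_mult power_add)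
  have N_ge: "Q k \<le> N k" for k
    using self_le_power[of "Q k" 4] by (simp add: N_def Q_def)
  obtain U d where E: "?E \<subseteq> (\<Union>i. U i)" and d: "\<And>i. 0 < (d i :: real)"
    "\<And>i y z. y \<in> U i \<Longrightarrow> z \<in> U i \<Longrightarrow> \<bar>y - z\<bar> \<le> d i"
    "summable (\<lambda>i. d i powr s)" "(\<Sum>i. d i powr s) < (1 / real (Q 0)) powr s / 10"
    by (rule hausdorff_measure_0_cover[OF zero s(1), of "(1 / real (Q 0)) powr s / 10"]) (use Q0 in auto)
  interpret obstacle_course s Q N "\<lambda>q. c / weight q" d U
  proof
    show "0 < Q 0" using Q0 by simp
    show "2 \<le> N k" for k using N_ge[of k] Q_ge_2[of k] by simp
    show "10 \<le> real (N k) powr (1 - s)" for k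
    proof -
      have "10 powr (1 / (1 - s)) \<le> real (N k)"
        using n Q_ge_real[of k] N_ge[of k] by linarith
      then have "(10 powr (1 / (1 - s))) powr (1 - s) \<le> real (N k) powr (1 - s)"
        using s by (intro powr_mono2) auto
      then show ?thesis using s by (simp add: powr_powr)
    qed
    show "0 < c / weight q" if "Q 0 \<le> q" for q
      using that Q0 c weight_pos[of q] by simp
    show "(\<Sum>q\<in>{Q k..<Q (Suc k)}. c / weight q) \<le> 1 / 400" for k
    proof -
      have "(\<Sum>q\<in>{Q k..<Q (Suc k)}. c / weight q) = c * (\<Sum>q\<in>{2 ^ (n * 5 ^ k)..<2 ^ (5 * (n * 5 ^ k))}. 1 / weight q)"
        by (simp add: Q_def sum_distrib_left mult_ac)
      also have "\<dots> \<le> c * C" using n1 c by (intro mult_left_mono C) auto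
      also have "\<dots> = 1 / 400" using C by (simp add: c_def)
      finally show ?thesis .
    qed
    show "1 / real (Q (Suc k)) \<le> 2 * (c / weight q) / real q" if "Q 0 \<le> q" "q < Q k" for k q
    proof -
      have q: "2 \<le> q" using that Q0 by simp
      have "1 / (2 * c) \<le> real (Q k)" using n Q_ge_real[of k] by linarith
      then have Qc: "1 \<le> 2 * c * real (Q k)" using c by (simp add: field_simps)
      \<comment> \<open>Of \<open>Q (Suc k) = Q k ^ 5\<close>, four factors dominate
        \<open>weight q * q\<close> and the fifth compensates the small constant
        \<open>2 * c\<close>.\<close>
      have "weight q * real q \<le> real q ^ 3 * real q" using weight_le[OF q] by (intro mult_right_mono) auto
      also have "\<dots> = real q ^ 4" by (simp add: eval_nat_numeral)
      also have "\<dots> \<le> real (Q k) ^ 4" using that by (intro power_mono) auto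
      also have "\<dots> = real (N k)" by (simp add: N_def)
      finally have "weight q * real q * 1 \<le> real (N k) * (2 * c * real (Q k))"
        using Qc by (intro mult_mono) auto
      then have "weight q * real q \<le> 2 * c * real (Q (Suc k))" by (simp add: Q_Suc mult_ac)
      moreover have "0 < real (Q (Suc k))" by (simp add: Q_def)
      ultimately show ?thesis using weight_pos[OF q] q by (simp add: field_simps)
    qed
  qed (use s Q_Suc d in auto)
  obtain \<beta> where \<beta>: "\<And>i. \<beta> \<notin> U i" "\<And>q. Q 0 \<le> q \<Longrightarrow> c / weight q \<le> dist_nint (real q * \<beta>)"
    using avoiding_point by blast
  have "c \<le> weight q * dist_nint (real q * \<beta>)" if "Q 0 \<le> q" for q
  proof -
    have "0 < weight q" using that Q_ge_2[of 0] by (intro weight_pos) simp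
    then show ?thesis using \<beta>(2)[OF that] by (simp add: field_simps)
  qed
  then have "ereal c \<le> liminf (\<lambda>q. ereal (weight q * dist_nint (real q * \<beta>)))"
    by (intro Liminf_bounded eventually_sequentiallyI[of "Q 0"]) simp
  moreover have "0 < ereal c" using c by simp
  ultimately have "\<beta> \<in> ?E" by (simp only: mem_Collect_eq)
  then show False using E \<beta>(1) by blast
qed

end

theorem theorem3:
  fixes a \<alpha> :: real
  assumes "0 < a" and "a < 1"
    and "(INF q \<in> {1::nat..}. real q * dist_nint (real q * \<alpha>)) > 0"
  shows "hausdorff_dim
           {\<beta>::real. liminf (\<lambda>q::nat. ereal (real q * ln (real q) powr (2 - a)
                * (ln (1 / dist_nint (real q * \<alpha>))) powr a
                * dist_nint (real q * \<alpha>) * dist_nint (real q * \<beta>))) > 0} = 1"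
proof -
  interpret badly_approximable \<alpha> "INF q \<in> {1::nat..}. real q * dist_nint (real q * \<alpha>)" a
  proof
    show "(INF q \<in> {1::nat..}. real q * dist_nint (real q * \<alpha>)) \<le> real q * dist_nint (real q * \<alpha>)"
      if "1 \<le> q" for q
      using that by (intro cINF_lower bdd_belowI2[of _ 0] mult_nonneg_nonneg dist_nint_nonneg) auto
  qed (use assms in auto)
  let ?E = "{\<beta>. liminf (\<lambda>q. ereal (weight q * dist_nint (real q * \<beta>))) > 0}"
  let ?S = "{s. s > 0 \<and> hausdorff_measure s ?E = 0}"
  have lower: "1 \<le> s" if "s \<in> ?S" for s
    using that hausdorff_measure_ne_0[of s] by force
  have upper: "s \<in> ?S" if "1 < s" for s
    using that hausdorff_measure_eq_0 by simp
  \<comment> \<open>\<open>?S\<close> contains every \<open>s > 1\<close> and nothing below 1, so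
    the infimum is 1 whether or not 1 itself belongs to it.\<close>
  have "Inf ?S = 1"
  proof (rule antisym)
    show "1 \<le> Inf ?S" using lower upper[of 2] by (intro cInf_greatest) (force, blast)
    show "Inf ?S \<le> 1"
    proof (rule dense_ge)
      fix s :: real assume "1 < s"
      then show "Inf ?S \<le> s" using lower by (intro cInf_lower upper bdd_belowI[of _ 1])
    qed
  qed
  then show ?thesis unfolding hausdorff_dim_def weight_def .
qed

end
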